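(* Let $\mathcal{A}$ and $\mathcal{U}$ be Banach algebras such that $\mathcal{U}$ is a Banach $\mathcal{A}$-bimodule with compatible actions and norm, and let $D$ be a derivation on $\mathcal{A}\ltimes\mathcal{U}$ written as $$D((a,x))=(\delta_1(a)+\tau_1(x),\,\delta_2(a)+\tau_2(x))\qquad((a,x)\in\mathcal{A}\ltimes\mathcal{U}).$$ Then: (i) If $ann_{\mathcal{A}}\mathcal{U}=(0)$ and $\tau_2$ and $\delta_2$ are continuous, then $D$ is continuous. (ii) If $ann_{\mathcal{U}}\mathcal{U}=(0)$ and $\tau_2$ and $\delta_1$ are continuous, then $\delta_2$ is continuous. If in addition $\tau_1$ is continuous, then $D$ is continuous.
   Context: All algebras are over $\mathbb{C}$. "Banach $\mathcal{A}$-bimodule with compatible actions and norm" means: $\|ax\|\le\|a\|\|x\|$, $\|xa\|\le\|x\|\|a\|$, and $a(xy)=(ax)y$, $(xy)a=x(ya)$, $(xa)y=x(ay)$ for all $a\in\mathcal{A}$, $x,y\in\mathcal{U}$. The semidirect product $\mathcal{A}\ltimes\mathcal{U}$ is $\mathcal{A}\times\mathcal{U}$ with multiplication $(a,x)(b,y)=(ab,\,ay+xb+xy)$ and norm $\|(a,x)\|=\|a\|+\|x\|$. A derivation on an algebra $\mathcal{B}$ is a linear map $D:\mathcal{B}\to\mathcal{B}$ (not assumed continuous) with $D(bc)=bD(c)+D(b)c$. The linear maps $\delta_1:\mathcal{A}\to\mathcal{A}$, $\delta_2:\mathcal{A}\to\mathcal{U}$, $\tau_1:\mathcal{U}\to\mathcal{A}$,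 $\tau_2:\mathcal{U}\to\mathcal{U}$ are the components of $D$: $D((a,0))=(\delta_1(a),\delta_2(a))$ and $D((0,x))=(\tau_1(x),\tau_2(x))$. Further, $ann_{\mathcal{A}}\mathcal{U}=\{a\in\mathcal{A}\mid a\mathcal{U}=\mathcal{U}a=(0)\}$ and $ann_{\mathcal{U}}\mathcal{U}=\{x\in\mathcal{U}\mid x\mathcal{U}=\mathcal{U}x=(0)\}$. *)

theory Defs
  imports "HOL-Analysis.Analysis"
begin

text \<open>
  HOL-Analysis only has real normed spaces and algebras, so the complex scalar action is added
  here; it extends the real one.
\<close>

class scaleC =
  fixes scaleC :: "complex \<Rightarrow> 'a \<Rightarrow> 'a"  (infixr "*\<^sub>C" 75)

class complex_normed_vector = scaleC + real_normed_vector +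
  assumes scaleC_add_right: "c *\<^sub>C (x + y) = c *\<^sub>C x + c *\<^sub>C y"
    and scaleC_add_left: "(c + d) *\<^sub>C x = c *\<^sub>C x + d *\<^sub>C x"
    and scaleC_scaleC: "c *\<^sub>C (d *\<^sub>C x) = (c * d) *\<^sub>C x"
    and scaleC_one: "1 *\<^sub>C x = x"
    and scaleR_scaleC: "r *\<^sub>R x = complex_of_real r *\<^sub>C x"
    and norm_scaleC: "norm (c *\<^sub>C x) = cmod c * norm x"

text \<open>Not necessarily unital or commutative.\<close>

class complex_banach_algebra = complex_normed_vector + real_normed_algebra + banach +
  assumes mult_scaleC_left: "(c *\<^sub>C x) * y = c *\<^sub>C (x * y)"
    and mult_scaleC_right: "x * (c *\<^sub>C y) = c *\<^sub>C (x * y)"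

abbreviation clinear :: "('a::complex_normed_vector \<Rightarrow> 'b::complex_normed_vector) \<Rightarrow> bool" where
  "clinear f \<equiv> Vector_Spaces.linear (*\<^sub>C) (*\<^sub>C) f"

lemma vector_space_scaleC: "vector_space ((*\<^sub>C) :: complex \<Rightarrow> 'a::complex_normed_vector \<Rightarrow> 'a)"
  by unfold_locales
    (simp_all add: scaleC_add_right scaleC_add_left scaleC_scaleC scaleC_one)

locale banach_bimodule =
  fixes lact :: "'a::complex_banach_algebra \<Rightarrow> 'u::complex_banach_algebra \<Rightarrow> 'u"  (infixr "\<rhd>" 75)
    and ract :: "'u \<Rightarrow> 'a \<Rightarrow> 'u"  (infixl "\<lhd>" 75)
  assumes lact_linear_right: "clinear (\<lambda>x. a \<rhd> x)"
    and lact_linear_left: "clinear (\<lambda>a. a \<rhd> x)"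
    and ract_linear_left: "clinear (\<lambda>x. x \<lhd> a)"
    and ract_linear_right: "clinear (\<lambda>a. x \<lhd> a)"
    and lact_mult: "(a * b) \<rhd> x = a \<rhd> (b \<rhd> x)"
    and ract_mult: "x \<lhd> (a * b) = (x \<lhd> a) \<lhd> b"
    and lact_ract: "(a \<rhd> x) \<lhd> b = a \<rhd> (x \<lhd> b)"
    and norm_lact: "norm (a \<rhd> x) \<le> norm a * norm x"
    and norm_ract: "norm (x \<lhd> a) \<le> norm x * norm a"
    and lact_times: "a \<rhd> (x * y) = (a \<rhd> x) * y"
    and ract_times: "(x * y) \<lhd> a = x * (y \<lhd> a)"
    and ract_times_lact: "(x \<lhd> a) * y = x * (a \<rhd> y)"

definition ann_alg :: "('a::complex_banach_algebra \<Rightarrow> 'u::complex_banach_algebra \<Rightarrow> 'u) \<Rightarrow> ('u \<Rightarrow> 'a \<Rightarrow> 'u) \<Rightarrow> 'a set"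
  where "ann_alg lact ract = {a. \<forall>x. lact a x = 0 \<and> ract x a = 0}"

definition ann_self :: "'u::complex_banach_algebra set"
  where "ann_self = {x. \<forall>y. x * y = 0 \<and> y * x = 0}"

text \<open>
  The underlying space of the semidirect product is a separate type because the library norm on
  \<open>'a \<times> 'u\<close> is the Euclidean one. The product depends on the two actions, hence is not a type
  class operation but the function \<open>sd_times\<close> below.
\<close>

datatype ('a, 'u) semidirect = SD (alg_part: 'a) (mod_part: 'u)

instantiation semidirect :: (complex_normed_vector, complex_normed_vector) complex_normed_vector
begin

definition "0 = SD 0 0"
definition "p + q = SD (alg_part p + alg_part q) (mod_part p + mod_part q)"
definition "- p = SD (- alg_part p) (- mod_part p)"
definition "p - q = SD (alg_part p - alg_part q) (mod_part p - mod_part q)"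
definition "r *\<^sub>R p = SD (r *\<^sub>R alg_part p) (r *\<^sub>R mod_part p)"
definition "c *\<^sub>C p = SD (c *\<^sub>C alg_part p) (c *\<^sub>C mod_part p)"
definition "norm p = norm (alg_part p) + norm (mod_part p)"
definition "sgn p = inverse (norm p) *\<^sub>R (p :: ('a, 'b) semidirect)"
definition "dist p q = norm (p - q :: ('a, 'b) semidirect)"
definition "uniformity = (INF e\<in>{0<..}. principal {(p, q :: ('a, 'b) semidirect). dist p q < e})"
definition "open S \<longleftrightarrow> (\<forall>p\<in>S. \<forall>\<^sub>F (p', q) in uniformity. p' = p \<longrightarrow> (q :: ('a, 'b) semidirect) \<in> S)"

lemmas semidirect_vector_defs =
  zero_semidirect_def plus_semidirect_def uminus_semidirect_def minus_semidirect_def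
  scaleR_semidirect_def scaleC_semidirect_def norm_semidirect_def

instance
proof
  fix p q r :: "('a, 'b) semidirect" and s t :: real and c d :: complex
  show "dist p q = norm (p - q)" by (rule dist_semidirect_def)
  show "sgn p = inverse (norm p) *\<^sub>R p" by (rule sgn_semidirect_def)
  show "uniformity = (INF e\<in>{0<..}. principal {(p, q :: ('a, 'b) semidirect). dist p q < e})"
    by (rule uniformity_semidirect_def)
  show "open S \<longleftrightarrow> (\<forall>p\<in>S. \<forall>\<^sub>F (p', q) in uniformity. p' = p \<longrightarrow> q \<in> S)"
    for S :: "('a, 'b) semidirect set"
    by (rule open_semidirect_def)
  show "norm p = 0 \<longleftrightarrow> p = 0"
    by (cases p) (simp add: semidirect_vector_defs add_nonneg_eq_0_iff)
  have "norm (alg_part p + alg_part q) \<le> norm (alg_part p) + norm (alg_part q)"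
    "norm (mod_part p + mod_part q) \<le> norm (mod_part p) + norm (mod_part q)"
    by (rule norm_triangle_ineq)+
  then show "norm (p + q) \<le> norm p + norm q"
    by (simp add: semidirect_vector_defs)
qed (simp_all add: semidirect_vector_defs algebra_simps scaleC_add_right scaleC_add_left
      scaleC_scaleC scaleC_one norm_scaleC scaleR_scaleC[symmetric])

end

instance semidirect :: (complex_banach_algebra, complex_banach_algebra) banach
proof
  fix X :: "nat \<Rightarrow> ('a, 'b) semidirect"
  assume X: "Cauchy X"
  have "Cauchy (\<lambda>n. alg_part (X n))"
    unfolding Cauchy_def
  proof (intro allI impI)
    fix e :: real assume "e > 0"
    then obtain M where M: "\<And>m n. m \<ge> M \<Longrightarrow> n \<ge> M \<Longrightarrow> dist (X m) (X n) < e"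
      using X unfolding Cauchy_def by blast
    have "dist (alg_part p) (alg_part q) \<le> dist p q" for p q :: "('a, 'b) semidirect"
      by (simp add: dist_norm semidirect_vector_defs)
    then show "\<exists>M. \<forall>m\<ge>M. \<forall>n\<ge>M. dist (alg_part (X m)) (alg_part (X n)) < e"
      using M by (meson le_less_trans)
  qed
  then obtain a where a: "(\<lambda>n. alg_part (X n)) \<longlonglongrightarrow> a"
    by (auto simp: Cauchy_convergent_iff convergent_def)
  have "Cauchy (\<lambda>n. mod_part (X n))"
    unfolding Cauchy_def
  proof (intro allI impI)
    fix e :: real assume "e > 0"
    then obtain M where M: "\<And>m n. m \<ge> M \<Longrightarrow> n \<ge> M \<Longrightarrow> dist (X m) (X n) < e"
      using X unfolding Cauchy_def by blast
    have "dist (mod_part p) (mod_part q) \<le> dist p q" for p q :: "('a, 'b) semidirect"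
      by (simp add: dist_norm semidirect_vector_defs)
    then show "\<exists>M. \<forall>m\<ge>M. \<forall>n\<ge>M. dist (mod_part (X m)) (mod_part (X n)) < e"
      using M by (meson le_less_trans)
  qed
  then obtain x where x: "(\<lambda>n. mod_part (X n)) \<longlonglongrightarrow> x"
    by (auto simp: Cauchy_convergent_iff convergent_def)
  have "(\<lambda>n. norm (alg_part (X n) - a) + norm (mod_part (X n) - x)) \<longlonglongrightarrow> 0 + 0"
    using a x by (intro tendsto_add) (simp_all add: LIM_zero tendsto_norm_zero)
  then have "(\<lambda>n. dist (X n) (SD a x)) \<longlonglongrightarrow> 0"
    by (simp add: dist_norm semidirect_vector_defs)
  then have "X \<longlonglongrightarrow> SD a x"
    by (rule tendsto_dist_iff[THEN iffD2])
  then show "convergent X"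
    by (auto simp: convergent_def)
qed

definition sd_times ::
  "('a::complex_banach_algebra \<Rightarrow> 'u::complex_banach_algebra \<Rightarrow> 'u) \<Rightarrow> ('u \<Rightarrow> 'a \<Rightarrow> 'u) \<Rightarrow>
    ('a, 'u) semidirect \<Rightarrow> ('a, 'u) semidirect \<Rightarrow> ('a, 'u) semidirect"
  where "sd_times lact ract p q =
    SD (alg_part p * alg_part q)
       (lact (alg_part p) (mod_part q) + ract (mod_part p) (alg_part q) + mod_part p * mod_part q)"

text \<open>A derivation with respect to a given product; continuity is not part of the definition.\<close>

definition derivation_wrt ::
  "('b::complex_normed_vector \<Rightarrow> 'b \<Rightarrow> 'b) \<Rightarrow> ('b \<Rightarrow> 'b) \<Rightarrow> bool"
  where "derivation_wrt mul D \<longleftrightarrow>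
    clinear D \<and> (\<forall>b c. D (mul b c) = mul b (D c) + mul (D b) c)"

context banach_bimodule
begin

lemma lact_add: "a \<rhd> (x + y) = a \<rhd> x + a \<rhd> y" "(a + b) \<rhd> x = a \<rhd> x + b \<rhd> x"
  using lact_linear_right lact_linear_left
  by (simp_all add: Vector_Spaces.linear_iff)

lemma ract_add: "(x + y) \<lhd> a = x \<lhd> a + y \<lhd> a" "x \<lhd> (a + b) = x \<lhd> a + x \<lhd> b"
  using ract_linear_right ract_linear_left
  by (simp_all add: Vector_Spaces.linear_iff)

lemma sd_times_assoc:
  "sd_times lact ract (sd_times lact ract p q) r = sd_times lact ract p (sd_times lact ract q r)"
  by (simp add: sd_times_def lact_add ract_add lact_mult ract_mult lact_ract lact_times ract_times
      ract_times_lact algebra_simps)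

lemma norm_sd_times: "norm (sd_times lact ract p q) \<le> norm p * norm q"
proof -
  obtain a x b y where [simp]: "p = SD a x" "q = SD b y"
    by (metis semidirect.collapse)
  have "norm (a \<rhd> y + x \<lhd> b + x * y) \<le> norm (a \<rhd> y) + norm (x \<lhd> b) + norm (x * y)"
    by (metis add_right_mono norm_triangle_ineq order_trans)
  then have "norm (a * b) + norm (a \<rhd> y + x \<lhd> b + x * y)
      \<le> norm a * norm b + (norm a * norm y + norm x * norm b + norm x * norm y)"
    using norm_mult_ineq[of a b] norm_mult_ineq[of x y] norm_lact[of a y] norm_ract[of x b]
    by linarith
  then show ?thesis
    by (simp add: sd_times_def norm_semidirect_def algebra_simps)
qed

end

end

theory Submission
  imports Defs
begin

text \<open>
  Comparing the module components of the product rule for \<open>D\<close> on \<open>(a, 0)(0, x)\<close>, \<open>(0, x)(a, 0)\<close>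
  and \<open>(0, x)(0, y)\<close> gives the following identities and the mirror image of the first:

  \<^item> \<open>\<tau>\<^sub>2 (a \<rhd> x) = a \<rhd> \<tau>\<^sub>2 x + \<delta>\<^sub>1 a \<rhd> x + \<delta>\<^sub>2 a * x\<close> and
  \<^item> \<open>\<tau>\<^sub>2 (x * y) = x \<lhd> \<tau>\<^sub>1 y + x * \<tau>\<^sub>2 y + \<tau>\<^sub>1 x \<rhd> y + \<tau>\<^sub>2 x * y\<close>.

  Solved for one of the terms on the right, such an equation says that \<open>\<delta>\<^sub>1\<close>, \<open>\<tau>\<^sub>1\<close> or \<open>\<delta>\<^sub>2\<close>, followed by
  multiplication with a fixed element of the module, is continuous, since all the other terms are.
  An annihilator is the common kernel of these multiplications. So when it is zero they separate
  points, and the closed graph theorem turns the continuity of all the compositions into the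
  continuity of the map itself (\<open>bounded_linear_if_separating_tests\<close>): if \<open>s\<^sub>n\<close> tends to \<open>0\<close> and
  \<open>T s\<^sub>n\<close> tends to \<open>y\<close>, then every multiplication sends \<open>y\<close> to \<open>0\<close>, hence \<open>y = 0\<close>. Part (i) applies
  this to \<open>\<delta>\<^sub>1\<close> and \<open>\<tau>\<^sub>1\<close>, part (ii) to \<open>\<delta>\<^sub>2\<close>.

  The closed graph theorem itself is derived from the Baire category theorem by successive
  approximation.
\<close>

section \<open>The closed graph theorem\<close>

text \<open>
  The content of Baire's theorem for a linear map on a Banach space: the closures of the sets
  \<open>{x. norm (T x) \<le> n}\<close> cover the space, so one of them contains a ball. Differences of its points,
  rescaled, approximate every vector by one on which \<open>T\<close> is controlled. Relative error \<open>1/2\<close> is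
  enough to iterate.
\<close>

lemma linear_approximately_bounded:
  fixes T :: "'a::banach \<Rightarrow> 'b::real_normed_vector"
  assumes "linear T"
  obtains K where "K \<ge> 0"
    and "\<And>x. \<exists>v. norm (T v) \<le> K * norm x \<and> norm (x - v) \<le> norm x / 2"
proof -
  interpret linear T by fact
  define S where "S n = {x. norm (T x) \<le> real n}" for n :: nat
  have "\<exists>n. interior (closure (S n)) \<noteq> {}"
  proof (rule ccontr)
    assume "\<nexists>n. interior (closure (S n)) \<noteq> {}"
    then have empty: "interior (closure (S n)) = {}" for n
      by blast
    have "Met_TC.mtopology interior_of \<Union>(range (\<lambda>n. closure (S n))) = {}"
      by (rule Met_TC.metric_Baire_category_alt) (auto simp: complete_UNIV empty)
    moreover have "(\<Union>n. closure (S n)) = UNIV"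
    proof -
      have "x \<in> closure (S (nat \<lceil>norm (T x)\<rceil>))" for x
        by (rule subsetD[OF closure_subset]) (simp add: S_def)
      then show ?thesis by blast
    qed
    ultimately show False by simp
  qed
  then obtain n x0 where "x0 \<in> interior (closure (S n))"
    by blast
  then obtain r where r: "r > 0" "ball x0 r \<subseteq> closure (S n)"
    by (auto simp: mem_interior)
  \<comment> \<open>Two errors of \<open>r / 8\<close>, rescaled by \<open>1 / t = 2 * norm x / r\<close> below, give \<open>norm x / 2\<close>.\<close>
  have near: "\<exists>a. norm (T a) \<le> real n \<and> norm (a - p) < r / 8" if "norm (p - x0) < r" for p
  proof -
    have "p \<in> closure (S n)"
      using that r by (auto simp: dist_norm norm_minus_commute)
    then show ?thesis
      using \<open>r > 0\<close> by (auto simp: closure_approachable S_def dist_norm dest!: spec[of _ "r / 8"])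
  qed
  show ?thesis
  proof (rule that[of "4 * real n / r"])
    show "4 * real n / r \<ge> 0"
      using \<open>r > 0\<close> by simp
    fix x :: 'a
    show "\<exists>v. norm (T v) \<le> 4 * real n / r * norm x \<and> norm (x - v) \<le> norm x / 2"
    proof (cases "x = 0")
      case True
      then show ?thesis by (auto intro!: exI[of _ 0] simp: zero)
    next
      case False
      \<comment> \<open>Scaling by \<open>t\<close> brings \<open>x\<close> to norm \<open>r / 2\<close>, so that \<open>x0 + t *\<^sub>R x\<close> stays in the ball.\<close>
      define t where "t = r / (2 * norm x)"
      have t: "t > 0"
        using False \<open>r > 0\<close> by (simp add: t_def)
      have "norm (t *\<^sub>R x) < r"
        using False \<open>r > 0\<close> by (simp add: t_def)
      then obtain a where a: "norm (T a) \<le> real n" "norm (a - (x0 + t *\<^sub>R x)) < r / 8"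
        using near[of "x0 + t *\<^sub>R x"] by auto
      obtain b where b: "norm (T b) \<le> real n" "norm (b - x0) < r / 8"
        using near[of x0] \<open>r > 0\<close> by auto
      define v where "v = (1 / t) *\<^sub>R (a - b)"
      have "norm (T a - T b) \<le> 2 * real n"
        using norm_triangle_ineq4[of "T a" "T b"] a b by linarith
      then have "norm (T v) \<le> (1 / t) * (2 * real n)"
        using t by (simp add: v_def scale diff divide_right_mono)
      also have "\<dots> = 4 * real n / r * norm x"
        using False \<open>r > 0\<close> by (simp add: t_def field_simps)
      finally have 1: "norm (T v) \<le> 4 * real n / r * norm x" .
      define d where "d = (b - x0) - (a - (x0 + t *\<^sub>R x))"
      have "norm d \<le> r / 4"
        using norm_triangle_ineq4[of "b - x0" "a - (x0 + t *\<^sub>R x)"] a b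
        unfolding d_def by linarith
      then have "(1 / t) * norm d \<le> (1 / t) * (r / 4)"
        using t by (intro mult_left_mono) auto
      moreover have "x - v = (1 / t) *\<^sub>R d"
        using t by (simp add: v_def d_def algebra_simps)
      ultimately have "norm (x - v) \<le> (1 / t) * (r / 4)"
        using t by simp
      also have "\<dots> = norm x / 2"
        using False \<open>r > 0\<close> by (simp add: t_def field_simps)
      finally show ?thesis
        using 1 by blast
    qed
  qed
qed

text \<open>
  The hypothesis \<open>closed\<close> is the usual sequential form of a closed graph, reduced by linearity to
  sequences tending to \<open>0\<close>. Iterating the approximation writes \<open>x\<close> as a series \<open>\<Sum>v\<^sub>k\<close> for which
  \<open>\<Sum>T v\<^sub>k\<close> is dominated by a geometric series; the hypothesis identifies its sum with \<open>T x\<close>.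
\<close>

theorem closed_graph_theorem:
  fixes T :: "'a::banach \<Rightarrow> 'b::banach"
  assumes "linear T"
    and closed: "\<And>s y. s \<longlonglongrightarrow> 0 \<Longrightarrow> (\<lambda>n. T (s n)) \<longlonglongrightarrow> y \<Longrightarrow> y = 0"
  shows "bounded_linear T"
proof -
  interpret linear T by fact
  obtain K where K: "K \<ge> 0"
    and approx: "\<And>x. \<exists>v. norm (T v) \<le> K * norm x \<and> norm (x - v) \<le> norm x / 2"
    by (rule linear_approximately_bounded[OF \<open>linear T\<close>]) blast
  from approx obtain V where V: "\<And>x. norm (T (V x)) \<le> K * norm x"
      "\<And>x. norm (x - V x) \<le> norm x / 2"
    by metis
  have "norm (T x) \<le> norm x * (2 * K)" for x
  proof -
    \<comment> \<open>\<open>z n\<close> is the remainder left after \<open>n\<close> approximation steps.\<close>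
    define z where "z n = ((\<lambda>z. z - V z) ^^ n) x" for n
    have z_0: "z 0 = x" and z_Suc: "z (Suc n) = z n - V (z n)" for n
      by (simp_all add: z_def)
    have z_le: "norm (z n) \<le> norm x * (1 / 2) ^ n" for n
    proof (induction n)
      case (Suc n)
      then show ?case using V(2)[of "z n"] by (simp add: z_Suc)
    qed (simp add: z_0)
    have geometric: "(\<lambda>n. norm x * (1 / 2 :: real) ^ n) sums (norm x * 2)"
      using geometric_sums[of "1 / 2 :: real"] by (intro sums_mult) simp
    have "z \<longlonglongrightarrow> 0"
      using z_le by (intro Lim_null_comparison[OF _ summable_LIMSEQ_zero[OF sums_summable[OF geometric]]]) auto
    define w where "w n = T (V (z n))" for n
    have w_le: "norm (w n) \<le> K * (norm x * (1 / 2) ^ n)" for n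
      using V(1)[of "z n"] mult_left_mono[OF z_le K, of n] unfolding w_def by linarith
    have geometric_K: "(\<lambda>n. K * (norm x * (1 / 2 :: real) ^ n)) sums (K * (norm x * 2))"
      by (rule sums_mult[OF geometric])
    have "summable w"
      using sums_summable[OF geometric_K] w_le by (rule summable_comparison_test'[where N = 0])
    have T_z: "T (z n) = T x - (\<Sum>k<n. w k)" for n
      by (induction n) (simp_all add: z_0 z_Suc w_def diff)
    have "(\<lambda>n. T (z n)) \<longlonglongrightarrow> T x - suminf w"
      unfolding T_z by (intro tendsto_diff tendsto_const summable_LIMSEQ \<open>summable w\<close>)
    with \<open>z \<longlonglongrightarrow> 0\<close> have "T x = suminf w"
      using closed by fastforce
    also have "norm \<dots> \<le> (\<Sum>n. K * (norm x * (1 / 2) ^ n))"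
      using w_le sums_summable[OF geometric_K] by (rule norm_suminf_le)
    also have "\<dots> = norm x * (2 * K)"
      using sums_unique[OF geometric_K] by (metis mult.assoc mult.commute)
    finally show ?thesis .
  qed
  then show ?thesis
    by (rule bounded_linear_intro[OF add scale])
qed

text \<open>A continuous map satisfies the closed graph condition by uniqueness of limits.\<close>

lemma bounded_linear_if_continuous:
  fixes T :: "'a::banach \<Rightarrow> 'b::banach"
  assumes "linear T" and "continuous_on UNIV T"
  shows "bounded_linear T"
proof (rule closed_graph_theorem[OF \<open>linear T\<close>])
  fix s y assume "s \<longlonglongrightarrow> 0" and y: "(\<lambda>n. T (s n)) \<longlonglongrightarrow> y"
  then have "(\<lambda>n. T (s n)) \<longlonglongrightarrow> T 0"
    using \<open>continuous_on UNIV T\<close> by (auto simp: continuous_on_sequentially o_def)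
  with y show "y = 0"
    using LIMSEQ_unique linear_0[OF \<open>linear T\<close>] by metis
qed

text \<open>
  Continuity of a linear map between Banach spaces can be tested by composing with any family of
  continuous linear maps that separates points: such a family forces the graph to be closed.
\<close>

lemma bounded_linear_if_separating_tests:
  fixes T :: "'a::banach \<Rightarrow> 'b::banach" and F :: "('b \<Rightarrow> 'c::real_normed_vector) set"
  assumes "linear T"
    and test: "\<And>B. B \<in> F \<Longrightarrow> bounded_linear B"
    and compose: "\<And>B. B \<in> F \<Longrightarrow> bounded_linear (\<lambda>x. B (T x))"
    and separating: "\<And>y. (\<And>B. B \<in> F \<Longrightarrow> B y = 0) \<Longrightarrow> y = 0"
  shows "bounded_linear T"
proof (rule closed_graph_theorem[OF \<open>linear T\<close>])
  fix s y assume s: "s \<longlonglongrightarrow> 0" and y: "(\<lambda>n. T (s n)) \<longlonglongrightarrow> y"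
  show "y = 0"
  proof (rule separating)
    fix B assume B: "B \<in> F"
    have "(\<lambda>n. B (T (s n))) \<longlonglongrightarrow> B y"
      by (rule bounded_linear.tendsto[OF test[OF B] y])
    moreover have "(\<lambda>n. B (T (s n))) \<longlonglongrightarrow> 0"
      by (rule bounded_linear.tendsto_zero[OF compose[OF B] s])
    ultimately show "B y = 0"
      by (rule LIMSEQ_unique)
  qed
qed

section \<open>Continuity of the structure maps\<close>

lemma clinear_imp_linear: "clinear f \<Longrightarrow> linear f"
  by (rule linearI) (simp_all add: Vector_Spaces.linear_iff scaleR_scaleC)

lemma bounded_linear_alg_part:
  "bounded_linear (alg_part :: ('a::complex_normed_vector, 'u::complex_normed_vector) semidirect \<Rightarrow> 'a)"
  by (rule bounded_linear_intro[where K = 1]) (simp_all add: semidirect_vector_defs)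

lemma bounded_linear_mod_part:
  "bounded_linear (mod_part :: ('a::complex_normed_vector, 'u::complex_normed_vector) semidirect \<Rightarrow> 'u)"
  by (rule bounded_linear_intro[where K = 1]) (simp_all add: semidirect_vector_defs)

lemma bounded_linear_SD:
  assumes f: "bounded_linear f" and g: "bounded_linear g"
  shows "bounded_linear (\<lambda>x. SD (f x) (g x))"
proof -
  interpret f: bounded_linear f by fact
  interpret g: bounded_linear g by fact
  obtain K L where "\<And>x. norm (f x) \<le> norm x * K" "\<And>x. norm (g x) \<le> norm x * L"
    using f.bounded g.bounded by auto
  then have "norm (SD (f x) (g x)) \<le> norm x * (K + L)" for x
    by (simp add: norm_semidirect_def distrib_left add_mono)
  then show ?thesis
    by (intro bounded_linear_intro)
      (simp_all add: semidirect_vector_defs f.add g.add f.scaleR g.scaleR)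
qed

context banach_bimodule
begin

lemma bounded_bilinear_lact: "bounded_bilinear (\<rhd>)"
proof (rule bounded_bilinear.intro)
  show "\<exists>K. \<forall>a x. norm (a \<rhd> x) \<le> norm a * norm x * K"
    using norm_lact by (intro exI[of _ 1]) simp
qed (simp_all add: lact_add clinear_imp_linear[OF lact_linear_left, THEN linear_scale]
    clinear_imp_linear[OF lact_linear_right, THEN linear_scale])

lemma bounded_bilinear_ract: "bounded_bilinear (\<lhd>)"
proof (rule bounded_bilinear.intro)
  show "\<exists>K. \<forall>x a. norm (x \<lhd> a) \<le> norm x * norm a * K"
    using norm_ract by (intro exI[of _ 1]) simp
qed (simp_all add: ract_add clinear_imp_linear[OF ract_linear_left, THEN linear_scale]
    clinear_imp_linear[OF ract_linear_right, THEN linear_scale])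

lemmas bounded_linear_multiplications =
  bounded_bilinear.bounded_linear_left[OF bounded_bilinear_lact]
  bounded_bilinear.bounded_linear_right[OF bounded_bilinear_lact]
  bounded_bilinear.bounded_linear_left[OF bounded_bilinear_ract]
  bounded_bilinear.bounded_linear_right[OF bounded_bilinear_ract]
  bounded_linear_mult_left bounded_linear_mult_right

lemmas zero_actions [simp] =
  bounded_bilinear.zero_left[OF bounded_bilinear_lact]
  bounded_bilinear.zero_right[OF bounded_bilinear_lact]
  bounded_bilinear.zero_left[OF bounded_bilinear_ract]
  bounded_bilinear.zero_right[OF bounded_bilinear_ract]

text \<open>
  The maps \<open>a \<mapsto> a \<rhd> x\<close> and \<open>a \<mapsto> x \<lhd> a\<close>, for all \<open>x\<close>, have common kernel \<open>ann_alg\<close>, so they separate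
  points when this annihilator vanishes.
\<close>

lemma bounded_linear_if_actions_bounded:
  fixes T :: "'b::banach \<Rightarrow> 'a"
  assumes "ann_alg lact ract = {0}" and "linear T"
    and "\<And>x. bounded_linear (\<lambda>b. T b \<rhd> x)" and "\<And>x. bounded_linear (\<lambda>b. x \<lhd> T b)"
  shows "bounded_linear T"
proof (rule bounded_linear_if_separating_tests[OF \<open>linear T\<close>,
      where F = "range (\<lambda>x a. a \<rhd> x) \<union> range (\<lambda>x a. x \<lhd> a)"])
  fix a assume *: "\<And>B. B \<in> range (\<lambda>x a. a \<rhd> x) \<union> range (\<lambda>x a. x \<lhd> a) \<Longrightarrow> B a = 0"
  have "a \<in> ann_alg lact ract"
    using *[of "\<lambda>a. a \<rhd> _"] *[of "\<lambda>a. _ \<lhd> a"] by (auto simp: ann_alg_def)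
  then show "a = 0"
    using assms(1) by simp
qed (use assms in \<open>auto intro: bounded_linear_multiplications\<close>)

end

section \<open>Derivations on a semidirect product\<close>

locale semidirect_derivation = banach_bimodule lact ract
  for lact :: "'a::complex_banach_algebra \<Rightarrow> 'u::complex_banach_algebra \<Rightarrow> 'u"  (infixr "\<rhd>" 75)
    and ract :: "'u \<Rightarrow> 'a \<Rightarrow> 'u"  (infixl "\<lhd>" 75) +
  fixes D :: "('a, 'u) semidirect \<Rightarrow> ('a, 'u) semidirect"
    and \<delta>\<^sub>1 :: "'a \<Rightarrow> 'a" and \<delta>\<^sub>2 :: "'a \<Rightarrow> 'u" and \<tau>\<^sub>1 :: "'u \<Rightarrow> 'a" and \<tau>\<^sub>2 :: "'u \<Rightarrow> 'u"
  assumes derivation: "derivation_wrt (sd_times lact ract) D"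
    and linear_components: "linear \<delta>\<^sub>1" "linear \<delta>\<^sub>2" "linear \<tau>\<^sub>1" "linear \<tau>\<^sub>2"
    and D_SD: "D (SD a x) = SD (\<delta>\<^sub>1 a + \<tau>\<^sub>1 x) (\<delta>\<^sub>2 a + \<tau>\<^sub>2 x)"
begin

lemmas components_zero [simp] = linear_components[THEN linear_0]

lemma D_product:
  "D (sd_times lact ract p q) = sd_times lact ract p (D q) + sd_times lact ract (D p) q"
  using derivation by (simp add: derivation_wrt_def)

lemma \<tau>\<^sub>2_lact: "\<tau>\<^sub>2 (a \<rhd> x) = a \<rhd> \<tau>\<^sub>2 x + \<delta>\<^sub>1 a \<rhd> x + \<delta>\<^sub>2 a * x"
  using D_product[of "SD a 0" "SD 0 x"]
  by (simp add: sd_times_def D_SD plus_semidirect_def add.assoc)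

lemma \<tau>\<^sub>2_ract: "\<tau>\<^sub>2 (x \<lhd> a) = \<tau>\<^sub>2 x \<lhd> a + x \<lhd> \<delta>\<^sub>1 a + x * \<delta>\<^sub>2 a"
  using D_product[of "SD 0 x" "SD a 0"]
  by (simp add: sd_times_def D_SD plus_semidirect_def algebra_simps)

lemma \<tau>\<^sub>2_times: "\<tau>\<^sub>2 (x * y) = x \<lhd> \<tau>\<^sub>1 y + x * \<tau>\<^sub>2 y + \<tau>\<^sub>1 x \<rhd> y + \<tau>\<^sub>2 x * y"
  using D_product[of "SD 0 x" "SD 0 y"]
  by (simp add: sd_times_def D_SD plus_semidirect_def add.assoc)

text \<open>In \<open>\<tau>\<^sub>2_lact\<close> and \<open>\<tau>\<^sub>2_ract\<close> every term but the one with \<open>\<delta>\<^sub>1\<close> is continuous in \<open>a\<close>.\<close>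

lemma bounded_linear_\<delta>\<^sub>1:
  assumes "ann_alg lact ract = {0}" and \<tau>\<^sub>2: "bounded_linear \<tau>\<^sub>2" and \<delta>\<^sub>2: "bounded_linear \<delta>\<^sub>2"
  shows "bounded_linear \<delta>\<^sub>1"
proof (rule bounded_linear_if_actions_bounded[OF assms(1) linear_components(1)])
  fix x
  have "(\<lambda>a. \<delta>\<^sub>1 a \<rhd> x) = (\<lambda>a. \<tau>\<^sub>2 (a \<rhd> x) - a \<rhd> \<tau>\<^sub>2 x - \<delta>\<^sub>2 a * x)"
    by (simp add: \<tau>\<^sub>2_lact)
  then show "bounded_linear (\<lambda>a. \<delta>\<^sub>1 a \<rhd> x)"
    by (simp only:) (intro bounded_linear_sub bounded_linear_multiplications
        bounded_linear_compose[OF \<tau>\<^sub>2] bounded_linear_compose[OF bounded_linear_mult_left \<delta>\<^sub>2])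
  have "(\<lambda>a. x \<lhd> \<delta>\<^sub>1 a) = (\<lambda>a. \<tau>\<^sub>2 (x \<lhd> a) - \<tau>\<^sub>2 x \<lhd> a - x * \<delta>\<^sub>2 a)"
    by (simp add: \<tau>\<^sub>2_ract)
  then show "bounded_linear (\<lambda>a. x \<lhd> \<delta>\<^sub>1 a)"
    by (simp only:) (intro bounded_linear_sub bounded_linear_multiplications
        bounded_linear_compose[OF \<tau>\<^sub>2] bounded_linear_compose[OF bounded_linear_mult_right \<delta>\<^sub>2])
qed

text \<open>
  Both \<open>\<tau>\<^sub>1 x\<close> and \<open>\<tau>\<^sub>1 y\<close> occur in \<open>\<tau>\<^sub>2_times\<close>, but with \<open>y\<close> fixed the term \<open>x \<lhd> \<tau>\<^sub>1 y\<close> is the action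
  of one element of the algebra, hence continuous in \<open>x\<close>.
\<close>

lemma bounded_linear_\<tau>\<^sub>1:
  assumes "ann_alg lact ract = {0}" and \<tau>\<^sub>2: "bounded_linear \<tau>\<^sub>2"
  shows "bounded_linear \<tau>\<^sub>1"
proof (rule bounded_linear_if_actions_bounded[OF assms(1) linear_components(3)])
  fix y
  have "(\<lambda>x. \<tau>\<^sub>1 x \<rhd> y) = (\<lambda>x. \<tau>\<^sub>2 (x * y) - x \<lhd> \<tau>\<^sub>1 y - x * \<tau>\<^sub>2 y - \<tau>\<^sub>2 x * y)"
    by (simp add: \<tau>\<^sub>2_times)
  then show "bounded_linear (\<lambda>x. \<tau>\<^sub>1 x \<rhd> y)"
    by (simp only:) (intro bounded_linear_sub bounded_linear_multiplications
        bounded_linear_compose[OF \<tau>\<^sub>2] bounded_linear_compose[OF bounded_linear_mult_left \<tau>\<^sub>2])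
  have "(\<lambda>x. y \<lhd> \<tau>\<^sub>1 x) = (\<lambda>x. \<tau>\<^sub>2 (y * x) - y * \<tau>\<^sub>2 x - \<tau>\<^sub>1 y \<rhd> x - \<tau>\<^sub>2 y * x)"
    by (simp add: \<tau>\<^sub>2_times)
  then show "bounded_linear (\<lambda>x. y \<lhd> \<tau>\<^sub>1 x)"
    by (simp only:) (intro bounded_linear_sub bounded_linear_multiplications
        bounded_linear_compose[OF \<tau>\<^sub>2] bounded_linear_compose[OF bounded_linear_mult_right \<tau>\<^sub>2])
qed

text \<open>
  Here the tests are the multiplications of \<open>'u\<close>, with common kernel \<open>ann_self\<close>, and \<open>\<tau>\<^sub>2_lact\<close> and
  \<open>\<tau>\<^sub>2_ract\<close> are solved for the term with \<open>\<delta>\<^sub>2\<close>. These tests say nothing about \<open>\<tau>\<^sub>1\<close>, which occurs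
  in \<open>\<tau>\<^sub>2_times\<close> only through the module actions; this is why part (ii) assumes the continuity of \<open>\<tau>\<^sub>1\<close> separately.
\<close>

lemma bounded_linear_\<delta>\<^sub>2:
  assumes ann: "(ann_self :: 'u set) = {0}"
    and \<tau>\<^sub>2: "bounded_linear \<tau>\<^sub>2" and \<delta>\<^sub>1: "bounded_linear \<delta>\<^sub>1"
  shows "bounded_linear \<delta>\<^sub>2"
proof (rule bounded_linear_if_separating_tests[OF linear_components(2),
      where F = "range (\<lambda>x u. u * x) \<union> range (\<lambda>x u. x * u)"])
  have left: "bounded_linear (\<lambda>a. \<delta>\<^sub>2 a * x)" for x
  proof -
    have "(\<lambda>a. \<delta>\<^sub>2 a * x) = (\<lambda>a. \<tau>\<^sub>2 (a \<rhd> x) - a \<rhd> \<tau>\<^sub>2 x - \<delta>\<^sub>1 a \<rhd> x)"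
      by (simp add: \<tau>\<^sub>2_lact)
    then show ?thesis
      by (simp only:) (intro bounded_linear_sub bounded_linear_multiplications
          bounded_linear_compose[OF \<tau>\<^sub>2] bounded_linear_compose[OF _ \<delta>\<^sub>1, of "\<lambda>a. a \<rhd> x"])
  qed
  have right: "bounded_linear (\<lambda>a. x * \<delta>\<^sub>2 a)" for x
  proof -
    have "(\<lambda>a. x * \<delta>\<^sub>2 a) = (\<lambda>a. \<tau>\<^sub>2 (x \<lhd> a) - \<tau>\<^sub>2 x \<lhd> a - x \<lhd> \<delta>\<^sub>1 a)"
      by (simp add: \<tau>\<^sub>2_ract)
    then show ?thesis
      by (simp only:) (intro bounded_linear_sub bounded_linear_multiplications
          bounded_linear_compose[OF \<tau>\<^sub>2] bounded_linear_compose[OF _ \<delta>\<^sub>1, of "\<lambda>a. x \<lhd> a"])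
  qed
  fix B :: "'u \<Rightarrow> 'u" assume "B \<in> range (\<lambda>x u. u * x) \<union> range (\<lambda>x u. x * u)"
  then show "bounded_linear B" and "bounded_linear (\<lambda>a. B (\<delta>\<^sub>2 a))"
    using left right by (auto intro: bounded_linear_multiplications)
next
  fix u :: 'u assume *: "\<And>B. B \<in> range (\<lambda>x u. u * x) \<union> range (\<lambda>x u. x * u) \<Longrightarrow> B u = 0"
  have "u \<in> ann_self"
    using *[of "\<lambda>u. u * _"] *[of "\<lambda>u. _ * u"] by (auto simp: ann_self_def)
  then show "u = 0"
    unfolding ann by blast
qed

lemma continuous_D_if_components:
  assumes "bounded_linear \<delta>\<^sub>1" "bounded_linear \<delta>\<^sub>2" "bounded_linear \<tau>\<^sub>1" "bounded_linear \<tau>\<^sub>2"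
  shows "continuous_on UNIV D"
proof -
  have "D = (\<lambda>p. SD (\<delta>\<^sub>1 (alg_part p) + \<tau>\<^sub>1 (mod_part p)) (\<delta>\<^sub>2 (alg_part p) + \<tau>\<^sub>2 (mod_part p)))"
    using D_SD by (metis semidirect.collapse)
  then have "bounded_linear D"
    by (simp only:) (intro bounded_linear_SD bounded_linear_add assms[THEN bounded_linear_compose]
        bounded_linear_alg_part bounded_linear_mod_part)
  then show ?thesis
    by (rule linear_continuous_on)
qed

end

theorem proposition3p6:
  fixes lact :: "'a::complex_banach_algebra \<Rightarrow> 'u::complex_banach_algebra \<Rightarrow> 'u"
    and ract :: "'u \<Rightarrow> 'a \<Rightarrow> 'u"
    and D :: "('a, 'u) semidirect \<Rightarrow> ('a, 'u) semidirect"
    and \<delta>\<^sub>1 :: "'a \<Rightarrow> 'a" and \<delta>\<^sub>2 :: "'a \<Rightarrow> 'u" and \<tau>\<^sub>1 :: "'u \<Rightarrow> 'a" and \<tau>\<^sub>2 :: "'u \<Rightarrow> 'u"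
  assumes "banach_bimodule lact ract"
    and "derivation_wrt (sd_times lact ract) D"
    and "clinear \<delta>\<^sub>1" and "clinear \<delta>\<^sub>2" and "clinear \<tau>\<^sub>1" and "clinear \<tau>\<^sub>2"
    and "\<And>a x. D (SD a x) = SD (\<delta>\<^sub>1 a + \<tau>\<^sub>1 x) (\<delta>\<^sub>2 a + \<tau>\<^sub>2 x)"
  shows "(ann_alg lact ract = {0} \<and> continuous_on UNIV \<tau>\<^sub>2 \<and> continuous_on UNIV \<delta>\<^sub>2
            \<longrightarrow> continuous_on UNIV D) \<and>
         ((ann_self :: 'u set) = {0} \<and> continuous_on UNIV \<tau>\<^sub>2 \<and> continuous_on UNIV \<delta>\<^sub>1
            \<longrightarrow> continuous_on UNIV \<delta>\<^sub>2 \<and> (continuous_on UNIV \<tau>\<^sub>1 \<longrightarrow> continuous_on UNIV D))"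
proof -
  interpret semidirect_derivation lact ract D \<delta>\<^sub>1 \<delta>\<^sub>2 \<tau>\<^sub>1 \<tau>\<^sub>2
    using assms by (intro semidirect_derivation.intro semidirect_derivation_axioms.intro
        clinear_imp_linear)
  note bounded = linear_components[THEN bounded_linear_if_continuous]
  show ?thesis
  proof (intro conjI impI; elim conjE)
    assume "ann_alg lact ract = {0}" "continuous_on UNIV \<tau>\<^sub>2" "continuous_on UNIV \<delta>\<^sub>2"
    then show "continuous_on UNIV D"
      using bounded by (intro continuous_D_if_components bounded_linear_\<delta>\<^sub>1 bounded_linear_\<tau>\<^sub>1)
  next
    assume "(ann_self :: 'u set) = {0}" "continuous_on UNIV \<tau>\<^sub>2" "continuous_on UNIV \<delta>\<^sub>1"
    then have \<delta>\<^sub>2: "bounded_linear \<delta>\<^sub>2"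
      using bounded by (intro bounded_linear_\<delta>\<^sub>2)
    then show "continuous_on UNIV \<delta>\<^sub>2"
      by (rule linear_continuous_on)
    assume "continuous_on UNIV \<tau>\<^sub>1"
    with \<delta>\<^sub>2 show "continuous_on UNIV D"
      using bounded \<open>continuous_on UNIV \<tau>\<^sub>2\<close> \<open>continuous_on UNIV \<delta>\<^sub>1\<close>
      by (intro continuous_D_if_components)
  qed
qed

end
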